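(* Let $\mathcal{A}$ be a C$^*$-algebra (not necessarily unital), let $\mathcal{M}$ be a Banach $\mathcal{A}$-bimodule, and let $F:\mathcal{A}\to\mathcal{M}$ be a continuous generalized derivation of the third type. Then $F$ is a generalized derivation of the first type and of the second type.
   Context: Let $\mathcal{A}$ be a Banach algebra and $\mathcal{M}$ a Banach $\mathcal{A}$-bimodule; the bidual $\mathcal{M}^{**}$ is regarded as a Banach $\mathcal{A}$-bimodule in the canonical way (extending the module operations of $\mathcal{M}$). A derivation from $\mathcal{A}$ to an $\mathcal{A}$-bimodule is a linear map $d$ with $d(ab)=d(a)b+ad(b)$ for all $a,b\in\mathcal{A}$. A linear map $F:\mathcal{A}\to\mathcal{M}$ is a generalized derivation - \emph{of the first type} if there exists a derivation $d:\mathcal{A}\to\mathcal{M}^{**}$ with $F(ab)=F(a)b+ad(b)$ for all $a,b\in\mathcal{A}$; - \emph{of the second type} if there exists $\xi\in\mathcal{M}^{**}$ with $F(ab)=F(a)b+aF(b)-a\xi b$ for all $a,b\in\mathcal{A}$; - \emph{of the third type} if there exist two (not necessarily linear) mappings $G,H:\mathcal{A}\to\mathcal{M}$ with $F(ab)=G(a)b+aH(b)$ for all $a,b\in\mathcal{A}$. *)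

theory Defs
  imports "HOL-Analysis.Analysis"
begin

section \<open>Complex Banach spaces\<close>

text \<open>
  HOL-Analysis provides real normed spaces only. The classes below add a complex scalar
  multiplication that extends the real one and is compatible with the given norm.
\<close>

class complex_normed_vector = real_normed_vector +
  fixes scaleC :: "complex \<Rightarrow> 'a \<Rightarrow> 'a" (infixr "*\<^sub>C" 75)
  assumes scaleC_add_right: "c *\<^sub>C (x + y) = c *\<^sub>C x + c *\<^sub>C y"
    and scaleC_add_left: "(b + c) *\<^sub>C x = b *\<^sub>C x + c *\<^sub>C x"
    and scaleC_scaleC: "b *\<^sub>C (c *\<^sub>C x) = (b * c) *\<^sub>C x"
    and scaleR_scaleC: "r *\<^sub>R x = complex_of_real r *\<^sub>C x"
    and norm_scaleC: "norm (c *\<^sub>C x) = cmod c * norm x"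

class complex_banach = complex_normed_vector + banach

text \<open>\<open>real_normed_algebra\<close> does not require a unit.\<close>

class complex_banach_algebra = complex_banach + real_normed_algebra +
  assumes mult_scaleC_left: "(c *\<^sub>C x) * y = c *\<^sub>C (x * y)"
    and mult_scaleC_right: "x * (c *\<^sub>C y) = c *\<^sub>C (x * y)"

class cstar_algebra = complex_banach_algebra +
  fixes star :: "'a \<Rightarrow> 'a"
  assumes star_add: "star (x + y) = star x + star y"
    and star_scaleC: "star (c *\<^sub>C x) = cnj c *\<^sub>C star x"
    and star_mult: "star (x * y) = star y * star x"
    and star_star: "star (star x) = x"
    and cstar_identity: "norm (star x * x) = (norm x)\<^sup>2"

instantiation complex :: cstar_algebra
begin

definition scaleC_complex :: "complex \<Rightarrow> complex \<Rightarrow> complex"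
  where "scaleC_complex c x = c * x"

definition star_complex :: "complex \<Rightarrow> complex"
  where "star_complex = cnj"

instance
  by standard
    (auto simp: scaleC_complex_def star_complex_def algebra_simps norm_mult
      scaleR_conv_of_real power2_eq_square)

end

lemma vector_space_scaleC: "vector_space (scaleC :: complex \<Rightarrow> 'a \<Rightarrow> 'a::complex_normed_vector)"
proof
  fix x :: 'a
  show "1 *\<^sub>C x = x"
    using scaleR_scaleC[of 1 x] by simp
qed (simp_all add: scaleC_add_right scaleC_add_left scaleC_scaleC)

definition clinear :: "('a::complex_normed_vector \<Rightarrow> 'b::complex_normed_vector) \<Rightarrow> bool"
  where "clinear = Vector_Spaces.linear scaleC scaleC"

lemma clinear_iff:
  "clinear f \<longleftrightarrow> (\<forall>x y. f (x + y) = f x + f y) \<and> (\<forall>c x. f (c *\<^sub>C x) = c *\<^sub>C f x)"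
  unfolding clinear_def Vector_Spaces.linear_def module_hom_def module_hom_axioms_def
  by (auto simp: module_iff_vector_space vector_space_scaleC)

section \<open>The dual of a complex normed space\<close>

typedef (overloaded) ('a::complex_normed_vector) cdual =
  "{f :: 'a \<Rightarrow>\<^sub>L complex. clinear (blinfun_apply f)}"
  morphisms blinfun_of_cdual Abs_cdual
  by (rule exI[of _ 0]) (simp add: clinear_iff scaleC_complex_def)

setup_lifting type_definition_cdual

definition cdual_apply :: "'a::complex_normed_vector cdual \<Rightarrow> 'a \<Rightarrow> complex"
  where "cdual_apply f = blinfun_apply (blinfun_of_cdual f)"

definition cdual_of :: "('a::complex_normed_vector \<Rightarrow> complex) \<Rightarrow> 'a cdual"
  where "cdual_of f = Abs_cdual (Blinfun f)"

lemma cdual_apply_cdual_of: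
  assumes "bounded_linear f" "clinear f"
  shows "cdual_apply (cdual_of f) = f"
  using assms by (simp add: cdual_apply_def cdual_of_def Abs_cdual_inverse bounded_linear_Blinfun_apply)

lemma bounded_linear_cdual_apply: "bounded_linear (cdual_apply f)"
  unfolding cdual_apply_def by (rule blinfun.bounded_linear_right)

lemma clinear_cdual_apply: "clinear (cdual_apply f)"
  using blinfun_of_cdual[of f] by (simp add: cdual_apply_def)

lemma cdual_eqI: "(\<And>x. cdual_apply f x = cdual_apply g x) \<Longrightarrow> f = g"
  by (simp add: cdual_apply_def blinfun_of_cdual_inject[symmetric] blinfun_eqI)

instantiation cdual :: (complex_normed_vector) complex_normed_vector
begin

lift_definition zero_cdual :: "'a cdual" is 0
  by (simp add: clinear_iff scaleC_complex_def)

lift_definition plus_cdual :: "'a cdual \<Rightarrow> 'a cdual \<Rightarrow> 'a cdual" is "(+)"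
  by (simp add: clinear_iff scaleC_complex_def blinfun.add_left algebra_simps)

lift_definition minus_cdual :: "'a cdual \<Rightarrow> 'a cdual \<Rightarrow> 'a cdual" is "(-)"
  by (simp add: clinear_iff scaleC_complex_def blinfun.diff_left algebra_simps)

lift_definition uminus_cdual :: "'a cdual \<Rightarrow> 'a cdual" is uminus
  by (simp add: clinear_iff scaleC_complex_def blinfun.minus_left algebra_simps)

lift_definition scaleR_cdual :: "real \<Rightarrow> 'a cdual \<Rightarrow> 'a cdual" is scaleR
  by (simp add: clinear_iff scaleC_complex_def blinfun.scaleR_left scaleR_conv_of_real algebra_simps)

definition scaleC_cdual :: "complex \<Rightarrow> 'a cdual \<Rightarrow> 'a cdual"
  where "scaleC_cdual c f = cdual_of (\<lambda>x. c * cdual_apply f x)"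

lift_definition norm_cdual :: "'a cdual \<Rightarrow> real" is norm .

definition dist_cdual :: "'a cdual \<Rightarrow> 'a cdual \<Rightarrow> real"
  where "dist_cdual f g = norm (f - g)"

definition sgn_cdual :: "'a cdual \<Rightarrow> 'a cdual"
  where "sgn_cdual f = inverse (norm f) *\<^sub>R f"

definition uniformity_cdual :: "('a cdual \<times> 'a cdual) filter"
  where "uniformity_cdual = (INF e\<in>{0 <..}. principal {(x, y). dist x y < e})"

definition open_cdual :: "'a cdual set \<Rightarrow> bool"
  where "open_cdual U = (\<forall>x\<in>U. \<forall>\<^sub>F (x', y) in uniformity. x' = x \<longrightarrow> y \<in> U)"

lemma cdual_apply_scaleC: "cdual_apply (c *\<^sub>C f) x = c * cdual_apply f x"
proof -
  have "clinear (\<lambda>x. c * cdual_apply f x)"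
    using clinear_cdual_apply[of f] by (simp add: clinear_iff scaleC_complex_def algebra_simps)
  then show ?thesis
    unfolding scaleC_cdual_def
    by (simp add: cdual_apply_cdual_of bounded_linear_const_mult bounded_linear_cdual_apply)
qed

lemma cdual_apply_add: "cdual_apply (f + g) x = cdual_apply f x + cdual_apply g x"
  by (simp add: cdual_apply_def plus_cdual.rep_eq blinfun.add_left)

lemma cdual_apply_scaleR: "cdual_apply (r *\<^sub>R f) x = r *\<^sub>R cdual_apply f x"
  by (simp add: cdual_apply_def scaleR_cdual.rep_eq blinfun.scaleR_left)

lemma norm_cdual_onorm: "norm f = onorm (cdual_apply f)"
  by (simp add: norm_cdual.rep_eq norm_blinfun.rep_eq cdual_apply_def)

instance
proof
  fix f g h :: "'a cdual" and r s :: real and b c :: complex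
  show "dist f g = norm (f - g)" by (rule dist_cdual_def)
  show "sgn f = inverse (norm f) *\<^sub>R f" by (rule sgn_cdual_def)
  show "uniformity = (INF e\<in>{0 <..}. principal {(x, y). dist x (y :: 'a cdual) < e})"
    by (rule uniformity_cdual_def)
  show "open U = (\<forall>x\<in>U. \<forall>\<^sub>F (x', y) in uniformity. x' = x \<longrightarrow> y \<in> U)" for U :: "'a cdual set"
    by (rule open_cdual_def)
  show "f + g + h = f + (g + h)" by transfer simp
  show "f + g = g + f" by transfer simp
  show "0 + f = f" by transfer simp
  show "- f + f = 0" by transfer simp
  show "f - g = f + - g" by transfer simp
  show "r *\<^sub>R (f + g) = r *\<^sub>R f + r *\<^sub>R g" by transfer (simp add: scaleR_add_right)
  show "(r + s) *\<^sub>R f = r *\<^sub>R f + s *\<^sub>R f" by transfer (simp add: scaleR_add_left)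
  show "r *\<^sub>R s *\<^sub>R f = (r * s) *\<^sub>R f" by transfer simp
  show "1 *\<^sub>R f = f" by transfer simp
  show "(norm f = 0) = (f = 0)" by transfer simp
  show "norm (f + g) \<le> norm f + norm g" by transfer (rule norm_triangle_ineq)
  show "norm (r *\<^sub>R f) = \<bar>r\<bar> * norm f" by transfer simp
  show "c *\<^sub>C (f + g) = c *\<^sub>C f + c *\<^sub>C g"
    by (rule cdual_eqI) (simp add: cdual_apply_scaleC cdual_apply_add algebra_simps)
  show "(b + c) *\<^sub>C f = b *\<^sub>C f + c *\<^sub>C f"
    by (rule cdual_eqI) (simp add: cdual_apply_scaleC cdual_apply_add algebra_simps)
  show "b *\<^sub>C c *\<^sub>C f = (b * c) *\<^sub>C f"
    by (rule cdual_eqI) (simp add: cdual_apply_scaleC)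
  show "r *\<^sub>R f = complex_of_real r *\<^sub>C f"
    by (rule cdual_eqI) (simp add: cdual_apply_scaleC cdual_apply_scaleR scaleR_conv_of_real)
  show "norm (c *\<^sub>C f) = cmod c * norm f"
  proof -
    have "onorm (\<lambda>x. c * cdual_apply f x) = onorm (\<lambda>x. cmod c *\<^sub>R cdual_apply f x)"
      by (simp add: onorm_def norm_mult)
    also have "\<dots> = cmod c * onorm (cdual_apply f)"
      by (simp add: onorm_scaleR bounded_linear_cdual_apply)
    finally show ?thesis
      by (simp add: norm_cdual_onorm cdual_apply_scaleC[abs_def])
  qed
qed

end

instance cdual :: (complex_normed_vector) complex_banach
proof
  fix X :: "nat \<Rightarrow> 'a cdual"
  assume X: "Cauchy X"
  let ?R = "blinfun_of_cdual :: 'a cdual \<Rightarrow> _"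
  have dist_R: "dist (?R f) (?R g) = dist f g" for f g
    by (simp add: dist_norm norm_cdual.rep_eq minus_cdual.rep_eq)
  have "Cauchy (\<lambda>n. ?R (X n))"
    using X by (simp add: Cauchy_def dist_R)
  then obtain f where f: "(\<lambda>n. ?R (X n)) \<longlonglongrightarrow> f"
    using Cauchy_convergent_iff convergent_def by blast
  have ap: "(\<lambda>n. cdual_apply (X n) x) \<longlonglongrightarrow> blinfun_apply f x" for x
    unfolding cdual_apply_def by (intro tendsto_intros f)
  have "blinfun_apply f (c *\<^sub>C x) = c * blinfun_apply f x" for c x
  proof (rule LIMSEQ_unique)
    show "(\<lambda>n. cdual_apply (X n) (c *\<^sub>C x)) \<longlonglongrightarrow> blinfun_apply f (c *\<^sub>C x)"
      by (rule ap)
    have "(\<lambda>n. c * cdual_apply (X n) x) \<longlonglongrightarrow> c * blinfun_apply f x"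
      by (intro tendsto_intros ap)
    then show "(\<lambda>n. cdual_apply (X n) (c *\<^sub>C x)) \<longlonglongrightarrow> c * blinfun_apply f x"
      using clinear_cdual_apply[of "X _"] by (simp add: clinear_iff scaleC_complex_def)
  qed
  then have "clinear (blinfun_apply f)"
    by (simp add: clinear_iff blinfun.add_right scaleC_complex_def)
  then obtain g where g: "f = ?R g"
    by (metis Abs_cdual_inverse mem_Collect_eq)
  have "X \<longlonglongrightarrow> g"
    using f unfolding g lim_sequentially by (simp add: dist_R)
  then show "convergent X"
    by (rule convergentI)
qed

section \<open>Banach bimodules and their biduals\<close>

text \<open>
  The left action \<open>L a x\<close> and the right action \<open>R x a\<close> are jointly continuous complex
  bilinear maps; \<open>bounded_bilinear\<close> supplies a constant \<open>K\<close> with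
  \<open>norm (L a x) \<le> norm a * norm x * K\<close>, which is not required to be \<open>1\<close>.
\<close>

locale banach_bimodule =
  fixes L :: "'a::complex_banach_algebra \<Rightarrow> 'm::complex_banach \<Rightarrow> 'm"
    and R :: "'m \<Rightarrow> 'a \<Rightarrow> 'm"
  assumes bounded_bilinear_left: "bounded_bilinear L"
    and bounded_bilinear_right: "bounded_bilinear R"
    and left_scaleC: "L (c *\<^sub>C a) x = c *\<^sub>C L a x" "L a (c *\<^sub>C x) = c *\<^sub>C L a x"
    and right_scaleC: "R (c *\<^sub>C x) a = c *\<^sub>C R x a" "R x (c *\<^sub>C a) = c *\<^sub>C R x a"
    and left_mult: "L (a * b) x = L a (L b x)"
    and right_mult: "R x (a * b) = R (R x a) b"
    and left_right: "R (L a x) b = L a (R x b)"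

text \<open>
  The dual actions are \<open>(a f)(x) = f(x a)\<close> and \<open>(f a)(x) = f(a x)\<close>, so the left action on the dual
  is built from the right action on the module and vice versa. The bidual actions are the
  dual actions of the dual actions.
\<close>

definition dual_left ::
  "('m \<Rightarrow> 'a \<Rightarrow> 'm) \<Rightarrow> 'a::complex_banach_algebra \<Rightarrow> 'm cdual \<Rightarrow> 'm::complex_banach cdual"
  where "dual_left R a f = cdual_of (\<lambda>x. cdual_apply f (R x a))"

definition dual_right ::
  "('a \<Rightarrow> 'm \<Rightarrow> 'm) \<Rightarrow> 'm cdual \<Rightarrow> 'a::complex_banach_algebra \<Rightarrow> 'm::complex_banach cdual"
  where "dual_right L f a = cdual_of (\<lambda>x. cdual_apply f (L a x))"

definition bidual_left ::
  "('a \<Rightarrow> 'm \<Rightarrow> 'm) \<Rightarrow> 'a::complex_banach_algebra \<Rightarrow> 'm cdual cdual \<Rightarrow> 'm::complex_banach cdual cdual"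
  where "bidual_left L = dual_left (dual_right L)"

definition bidual_right ::
  "('m \<Rightarrow> 'a \<Rightarrow> 'm) \<Rightarrow> 'm cdual cdual \<Rightarrow> 'a::complex_banach_algebra \<Rightarrow> 'm::complex_banach cdual cdual"
  where "bidual_right R = dual_right (dual_left R)"

definition to_bidual :: "'m::complex_normed_vector \<Rightarrow> 'm cdual cdual"
  where "to_bidual x = cdual_of (\<lambda>f. cdual_apply f x)"

lemma norm_cdual_apply_le: "norm (cdual_apply f x) \<le> norm f * norm x"
  by (simp add: norm_cdual_onorm onorm bounded_linear_cdual_apply)

lemma norm_cdual_le:
  assumes "\<And>x. norm (cdual_apply f x) \<le> b * norm x"
  shows "0 \<le> b \<Longrightarrow> norm f \<le> b"
  using assms by (simp add: norm_cdual_onorm onorm_le onorm_bound)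

lemma cdual_apply_to_bidual: "cdual_apply (to_bidual x) f = cdual_apply f x"
proof -
  have "bounded_linear (\<lambda>f. cdual_apply f x)"
    by (rule bounded_linear_intro[where K = "norm x"])
      (simp_all add: cdual_apply_add cdual_apply_scaleR norm_cdual_apply_le)
  moreover have "clinear (\<lambda>f. cdual_apply f x)"
    by (simp add: clinear_iff cdual_apply_add cdual_apply_scaleC scaleC_complex_def)
  ultimately show ?thesis
    by (simp add: to_bidual_def cdual_apply_cdual_of)
qed

context banach_bimodule
begin

lemma cdual_apply_dual_left: "cdual_apply (dual_left R a f) x = cdual_apply f (R x a)"
proof -
  have "bounded_linear (\<lambda>x. cdual_apply f (R x a))"
    by (rule bounded_linear_compose[OF bounded_linear_cdual_apply
          bounded_bilinear.bounded_linear_left[OF bounded_bilinear_right]])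
  moreover have "clinear (\<lambda>x. cdual_apply f (R x a))"
    using clinear_cdual_apply[of f] bounded_bilinear.add_left[OF bounded_bilinear_right]
    by (simp add: clinear_iff right_scaleC)
  ultimately show ?thesis
    by (simp add: dual_left_def cdual_apply_cdual_of)
qed

lemma cdual_apply_dual_right: "cdual_apply (dual_right L f a) x = cdual_apply f (L a x)"
proof -
  have "bounded_linear (\<lambda>x. cdual_apply f (L a x))"
    by (rule bounded_linear_compose[OF bounded_linear_cdual_apply
          bounded_bilinear.bounded_linear_right[OF bounded_bilinear_left]])
  moreover have "clinear (\<lambda>x. cdual_apply f (L a x))"
    using clinear_cdual_apply[of f] bounded_bilinear.add_right[OF bounded_bilinear_left]
    by (simp add: clinear_iff left_scaleC)
  ultimately show ?thesis
    by (simp add: dual_right_def cdual_apply_cdual_of)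
qed

lemma banach_bimodule_dual: "banach_bimodule (dual_left R) (dual_right L)"
proof -
  note ap = cdual_apply_dual_left cdual_apply_dual_right cdual_apply_add cdual_apply_scaleC
    cdual_apply_scaleR
  have ladd: "cdual_apply f (x + y) = cdual_apply f x + cdual_apply f y" for f and x y :: 'm
    using clinear_cdual_apply[of f] by (simp add: clinear_iff)
  have lsc: "cdual_apply f (c *\<^sub>C x) = c * cdual_apply f x" for f c and x :: 'm
    using clinear_cdual_apply[of f] by (simp add: clinear_iff scaleC_complex_def)
  have lsr: "cdual_apply f (r *\<^sub>R x) = r *\<^sub>R cdual_apply f x" for f r and x :: 'm
    by (simp add: linear_simps bounded_linear_cdual_apply)
  interpret bL: bounded_bilinear L by (rule bounded_bilinear_left)
  interpret bR: bounded_bilinear R by (rule bounded_bilinear_right)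
  obtain K where K: "0 \<le> K" "\<And>a x. norm (L a x) \<le> norm a * norm x * K"
    using bL.nonneg_bounded by blast
  obtain K' where K': "0 \<le> K'" "\<And>x a. norm (R x a) \<le> norm x * norm a * K'"
    using bR.nonneg_bounded by blast
  show ?thesis
  proof
    show "\<exists>K. \<forall>a f. norm (dual_left R a f) \<le> norm a * norm f * K"
    proof (intro exI allI norm_cdual_le)
      fix a f x
      have "norm (cdual_apply f (R x a)) \<le> norm f * (norm x * norm a * K')"
        by (rule order_trans[OF norm_cdual_apply_le mult_left_mono[OF K'(2) norm_ge_zero]])
      then show "norm (cdual_apply (dual_left R a f) x) \<le> norm a * norm f * K' * norm x"
        by (simp add: cdual_apply_dual_left mult_ac)
    qed (simp add: K')
    show "\<exists>K. \<forall>f a. norm (dual_right L f a) \<le> norm f * norm a * K"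
    proof (intro exI allI norm_cdual_le)
      fix a f x
      have "norm (cdual_apply f (L a x)) \<le> norm f * (norm a * norm x * K)"
        by (rule order_trans[OF norm_cdual_apply_le mult_left_mono[OF K(2) norm_ge_zero]])
      then show "norm (cdual_apply (dual_right L f a) x) \<le> norm f * norm a * K * norm x"
        by (simp add: cdual_apply_dual_right mult_ac)
    qed (simp add: K)
  qed (rule cdual_eqI; simp add: ap ladd lsc lsr bL.add_left bR.add_right bL.scaleR_left
      bR.scaleR_right left_scaleC right_scaleC left_mult right_mult left_right)+
qed

lemma banach_bimodule_bidual: "banach_bimodule (bidual_left L) (bidual_right R)"
  unfolding bidual_left_def bidual_right_def
  by (rule banach_bimodule.banach_bimodule_dual[OF banach_bimodule_dual])

lemma cdual_apply_bidual_left: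
  "cdual_apply (bidual_left L a \<xi>) f = cdual_apply \<xi> (dual_right L f a)"
  unfolding bidual_left_def
  by (rule banach_bimodule.cdual_apply_dual_left[OF banach_bimodule_dual])

lemma cdual_apply_bidual_right:
  "cdual_apply (bidual_right R \<xi> a) f = cdual_apply \<xi> (dual_left R a f)"
  unfolding bidual_right_def
  by (rule banach_bimodule.cdual_apply_dual_right[OF banach_bimodule_dual])

lemma bidual_left_to_bidual: "bidual_left L a (to_bidual x) = to_bidual (L a x)"
  by (rule cdual_eqI)
    (simp add: cdual_apply_bidual_left cdual_apply_to_bidual cdual_apply_dual_right)

lemma bidual_right_to_bidual: "bidual_right R (to_bidual x) a = to_bidual (R x a)"
  by (rule cdual_eqI)
    (simp add: cdual_apply_bidual_right cdual_apply_to_bidual cdual_apply_dual_left)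

end

section \<open>Generalized derivations\<close>

definition derivation ::
  "('a \<Rightarrow> 'm \<Rightarrow> 'm) \<Rightarrow> ('m \<Rightarrow> 'a \<Rightarrow> 'm)
    \<Rightarrow> ('a::complex_banach_algebra \<Rightarrow> 'm::complex_banach) \<Rightarrow> bool"
  where "derivation L R d \<longleftrightarrow> clinear d \<and> (\<forall>a b. d (a * b) = R (d a) b + L a (d b))"

text \<open>
  In the first two notions the identity relates elements of the module to elements of its
  bidual, so it is stated in the bidual along the canonical embedding \<open>to_bidual\<close>.
\<close>

definition generalized_derivation_first ::
  "('a \<Rightarrow> 'm \<Rightarrow> 'm) \<Rightarrow> ('m \<Rightarrow> 'a \<Rightarrow> 'm)
    \<Rightarrow> ('a::complex_banach_algebra \<Rightarrow> 'm::complex_banach) \<Rightarrow> bool"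
  where "generalized_derivation_first L R F \<longleftrightarrow> clinear F \<and>
    (\<exists>d. derivation (bidual_left L) (bidual_right R) d \<and>
      (\<forall>a b. to_bidual (F (a * b)) = to_bidual (R (F a) b) + bidual_left L a (d b)))"

definition generalized_derivation_second ::
  "('a \<Rightarrow> 'm \<Rightarrow> 'm) \<Rightarrow> ('m \<Rightarrow> 'a \<Rightarrow> 'm)
    \<Rightarrow> ('a::complex_banach_algebra \<Rightarrow> 'm::complex_banach) \<Rightarrow> bool"
  where "generalized_derivation_second L R F \<longleftrightarrow> clinear F \<and>
    (\<exists>\<xi>. \<forall>a b. to_bidual (F (a * b)) = to_bidual (R (F a) b) + to_bidual (L a (F b))
      - bidual_right R (bidual_left L a \<xi>) b)"

definition generalized_derivation_third ::
  "('a \<Rightarrow> 'm \<Rightarrow> 'm) \<Rightarrow> ('m \<Rightarrow> 'a \<Rightarrow> 'm)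
    \<Rightarrow> ('a::complex_banach_algebra \<Rightarrow> 'm::complex_banach) \<Rightarrow> bool"
  where "generalized_derivation_third L R F \<longleftrightarrow> clinear F \<and>
    (\<exists>G H. \<forall>a b. F (a * b) = R (G a) b + L a (H b))"

end

(* If F(ab) = G(a)b + aH(b), then F(abc) = F(ab)c + aF(bc) - aF(b)c: this is pure algebra when b is
   a product, and follows for all b with a bounded approximate identity and the continuity of F.
   Letting b run through the approximate identity gives F(ac) = F(a)c + aF(c) - a\<xi>c with a weak*
   cluster point \<xi> of the values F(b), and then d(b) = F(b) - \<xi>b is the derivation for the first
   type. The approximate identity is obtained without spectral theory: for a selfadjoint h of small
   norm the Cayley transform of ih is a unitary of the unitization, and the averages of its powers
   tend to 0 on multiples of h, by the mean ergodic argument. *)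

theory Submission
  imports Defs
begin

section \<open>Bounded approximate identities in C*-algebras\<close>

lemma star_scaleR: "star (r *\<^sub>R (x :: 'a::cstar_algebra)) = r *\<^sub>R star x"
  by (simp add: scaleR_scaleC star_scaleC)

lemma star_zero: "star (0 :: 'a::cstar_algebra) = 0"
  using star_scaleR[of 0 "0 :: 'a"] by simp

lemma star_minus: "star (- x :: 'a::cstar_algebra) = - star x"
  using star_scaleR[of "-1" x] by simp

lemma star_diff: "star (x - y :: 'a::cstar_algebra) = star x - star y"
  using star_add[of x "- y"] by (simp add: star_minus)

lemma norm_star:
  fixes x :: "'a::cstar_algebra"
  shows "norm (star x) = norm x"
proof -
  have le: "norm y \<le> norm (star y)" for y :: 'a
  proof (cases "y = 0")
    case False
    have "norm y * norm y \<le> norm (star y) * norm y"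
      using norm_mult_ineq[of "star y" y] by (simp add: cstar_identity power2_eq_square)
    with False show ?thesis by simp
  qed simp
  from le[of x] le[of "star x"] show ?thesis
    by (simp add: star_star)
qed

text \<open>Without a unit, \<open>1 + p\<close> being an isometry is expressed through \<open>p\<close> alone.\<close>

definition quasi_isometry :: "'a::cstar_algebra \<Rightarrow> bool"
  where "quasi_isometry p \<longleftrightarrow> star p * p + star p + p = 0"

text \<open>Moving the linear terms across gives \<open>star p * p = - (star p + p)\<close>, and the
  C*-identity turns this into norm p squared being at most 2 norm p. This uniform bound is what the
  averages of powers rely on.\<close>

lemma norm_quasi_isometry_le:
  assumes "quasi_isometry p"
  shows "norm p \<le> 2"
proof (cases "p = 0")
  case False
  have "star p * p = - (star p + p)"
    using assms by (simp only: quasi_isometry_def eq_neg_iff_add_eq_0 add.assoc)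
  then have "norm p * norm p = norm (star p + p)"
    using cstar_identity[of p] by (metis norm_minus_cancel power2_eq_square)
  also have "\<dots> \<le> 2 * norm p"
    using norm_triangle_ineq[of "star p" p] by (simp add: norm_star)
  finally show ?thesis using False by simp
qed simp

text \<open>Formally \<open>1 + (p + q + p * q)\<close> is \<open>(1 + p) * (1 + q)\<close>, a
  product of isometries.\<close>

lemma quasi_isometry_compose:
  assumes "quasi_isometry p" "quasi_isometry q"
  shows "quasi_isometry (p + q + p * q)"
proof -
  let ?X = "star p * p + star p + p" and ?r = "p + q + p * q"
  \<comment> \<open>With \<open>?X\<close> the defect of \<open>1 + p\<close>, the defect of the
    product is \<open>star (1 + q) * ?X * (1 + q)\<close>, written out, plus the defect of
    \<open>1 + q\<close>.\<close>
  have "star ?r * ?r + star ?r + ?r =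
      ?X + ?X * q + star q * ?X + star q * ?X * q + (star q * q + star q + q)"
    by (simp add: star_add star_mult algebra_simps)
  with assms show ?thesis by (simp add: quasi_isometry_def)
qed

section \<open>Cayley transform and ergodic averages\<close>

text \<open>The contraction principle replaces the Neumann series: it solves
  \<open>(1 - g) * w = 2 *\<^sub>R g\<close> without a unit.\<close>

lemma fixed_point_contracting_affine:
  fixes T :: "'a::banach \<Rightarrow> 'a"
  assumes T: "bounded_linear T" and "\<And>x. norm (T x) \<le> c * norm x" "c < 1" "0 \<le> c"
  obtains x where "x = y + T x"
proof -
  have "\<exists>!x. y + T x = x"
  proof (rule banach_fix_type[of c])
    show "\<forall>x z. dist (y + T x) (y + T z) \<le> c * dist x z"
      using assms(2) by (simp add: dist_norm flip: linear_simps(2)[OF T])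
  qed (use assms in auto)
  then show ?thesis using that by metis
qed

text \<open>\<open>1 + w\<close> is the Cayley transform \<open>(1 + g)(1 - g)\<^sup>-\<^sup>1\<close>.\<close>

lemma cayley_transform:
  fixes g :: "'a::cstar_algebra"
  assumes star: "star g = - g" and small: "norm g < 1"
  obtains w where "quasi_isometry w" "w = 2 *\<^sub>R g + g * w"
proof -
  obtain w where w: "w = 2 *\<^sub>R g + g * w"
    by (rule fixed_point_contracting_affine[of "(*) g" "norm g"])
      (use small in \<open>auto intro: bounded_linear_mult_right norm_mult_ineq\<close>)
  \<comment> \<open>The mirror equation \<open>w' * (1 - g) = 2 *\<^sub>R g\<close>. Evaluating
    \<open>w' * (1 - g) * w\<close> in two ways gives \<open>w' * g = g * w\<close>, so
    \<open>w' = w\<close> and \<open>w\<close> commutes with \<open>g\<close>.\<close>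
  obtain w' where w': "w' = 2 *\<^sub>R g + w' * g"
    by (rule fixed_point_contracting_affine[of "\<lambda>x. x * g" "norm g"])
      (use small in \<open>auto intro: bounded_linear_mult_left norm_mult_ineq simp: mult.commute[of "norm g"]\<close>)
  have "w' * (w - g * w) = (w' - w' * g) * w"
    by (simp add: algebra_simps)
  moreover have "w - g * w = 2 *\<^sub>R g" "w' - w' * g = 2 *\<^sub>R g"
    using w w' by (metis add_diff_cancel_right')+
  ultimately have "w' * g = g * w" by simp
  with w w' have w_right: "w = 2 *\<^sub>R g + w * g" by metis
  let ?v = "star w"
  have "?v = star (2 *\<^sub>R g + w * g)"
    using w_right by simp
  \<comment> \<open>Taking adjoints reverses products, so the version with \<open>g\<close> on the
    right yields an equation with \<open>g\<close> on the left again.\<close>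
  then have v: "?v = - (2 *\<^sub>R g) - g * ?v"
    by (simp add: star_add star_scaleR star_mult star)
  \<comment> \<open>\<open>s\<close> is the defect of \<open>1 + w\<close>. It satisfies
    \<open>(1 + g) * s = 0\<close>, which forces \<open>s = 0\<close> because the norm of
    \<open>g\<close> is below 1.\<close>
  define s where "s = ?v * w + ?v + w"
  have "s + g * s = (?v + g * ?v) * w + (?v + g * ?v) + (w + g * w)"
    by (simp add: s_def algebra_simps)
  also have "?v + g * ?v = - (2 *\<^sub>R g)"
    using v by (metis diff_add_cancel)
  also have "- (2 *\<^sub>R g) * w + - (2 *\<^sub>R g) + (w + g * w) = w - (2 *\<^sub>R g + g * w)"
    by (simp add: scaleR_2 algebra_simps)
  also have "\<dots> = 0" using w by simp
  finally have "s = - (g * s)" by (simp add: eq_neg_iff_add_eq_0)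
  then have "norm s \<le> norm g * norm s"
    by (metis norm_minus_cancel norm_mult_ineq)
  then have "s = 0"
    using small by (metis mult_le_cancel_right1 norm_le_zero_iff not_less)
  then have "quasi_isometry w" by (simp add: quasi_isometry_def s_def)
  with w that show ?thesis by blast
qed

text \<open>\<open>1 + quasi_power w k = (1 + w)\<^sup>k\<close>.\<close>

primrec quasi_power :: "'a::ring \<Rightarrow> nat \<Rightarrow> 'a"
  where
    "quasi_power w 0 = 0"
  | "quasi_power w (Suc k) = w + quasi_power w k + w * quasi_power w k"

lemma quasi_isometry_quasi_power: "quasi_isometry w \<Longrightarrow> quasi_isometry (quasi_power w k)"
proof (induction k)
  case 0
  then show ?case by (simp add: quasi_isometry_def star_zero)
qed (simp add: quasi_isometry_compose)

text \<open>The mean ergodic argument: \<open>1 - u\<close> is the average of the powers \<open>(1 + w)\<^sup>k\<close>, \<open>k < N\<close>,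
  so \<open>w (1 - u) = ((1 + w)\<^sup>N - 1) / N\<close> telescopes.\<close>

lemma skew_approximate_unit:
  fixes g :: "'a::cstar_algebra"
  assumes "star g = - g" "norm g < 1" "0 < \<epsilon>"
  obtains u where "norm u \<le> 2" "norm (g - g * u) < \<epsilon>"
proof -
  obtain w where w: "quasi_isometry w" "w = 2 *\<^sub>R g + g * w"
    using cayley_transform assms by blast
  \<comment> \<open>The telescoped average has norm at most \<open>2 / real N\<close>.\<close>
  obtain N :: nat where N: "2 / \<epsilon> < real N" using reals_Archimedean2 by blast
  with assms have Npos: "0 < real N" by (smt (verit) divide_pos_pos)
  define u where "u = - ((1 / real N) *\<^sub>R (\<Sum>k<N. quasi_power w k))"
  have qp: "norm (quasi_power w k) \<le> 2" for k
    by (intro norm_quasi_isometry_le quasi_isometry_quasi_power w)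
  have "norm (\<Sum>k<N. quasi_power w k) \<le> real N * 2"
    using sum_norm_bound[of "{..<N}" "quasi_power w" 2] qp by simp
  then have u: "norm u \<le> 2"
    using Npos by (simp add: u_def divide_simps mult.commute)
  have "w - w * u = (1 / real N) *\<^sub>R (\<Sum>k<N. w + w * quasi_power w k)"
    using Npos by (simp add: u_def sum.distrib sum_distrib_left scaleR_add_right sum_constant_scaleR)
  also have "(\<Sum>k<N. w + w * quasi_power w k) = (\<Sum>k<N. quasi_power w (Suc k) - quasi_power w k)"
    by (simp add: algebra_simps)
  also have "\<dots> = quasi_power w N"
    by (simp only: sum_lessThan_telescope) simp
  finally have eq: "w - w * u = (1 / real N) *\<^sub>R quasi_power w N" .
  have wu: "norm (w - w * u) \<le> 2 / real N"
    using qp[of N] Npos by (simp add: eq divide_right_mono)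
  \<comment> \<open>The estimate passes from \<open>w\<close> to \<open>g\<close> through
    \<open>2 *\<^sub>R g = (1 - g) * w\<close>; the factor \<open>1 - g\<close> at most doubles the
    norm, which cancels the 2 on the left.\<close>
  have "2 *\<^sub>R (g - g * u) = (2 *\<^sub>R g) - (2 *\<^sub>R g) * u"
    by (simp add: scaleR_diff_right)
  also have "2 *\<^sub>R g = w - g * w"
    using w(2) by (metis add_diff_cancel_right')
  also have "(w - g * w) - (w - g * w) * u = (w - w * u) - g * (w - w * u)"
    by (simp add: algebra_simps)
  finally have "2 * norm (g - g * u) = norm ((w - w * u) - g * (w - w * u))"
    by (metis abs_numeral norm_scaleR)
  also have "\<dots> \<le> norm (w - w * u) + norm g * norm (w - w * u)"
    by (rule order_trans[OF norm_triangle_ineq4]) (simp add: norm_mult_ineq)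
  also have "\<dots> \<le> 2 * norm (w - w * u)"
    using assms(2) mult_right_mono[of "norm g" 1 "norm (w - w * u)"] by simp
  finally have "norm (g - g * u) \<le> 2 / real N" using wu by simp
  also have "\<dots> < \<epsilon>" using N Npos assms(3) by (simp add: field_simps)
  finally show ?thesis using u that by blast
qed

section \<open>From single elements to a bounded approximate identity\<close>

text \<open>The C*-identity reduces \<open>b\<close> to the selfadjoint
  \<open>h = star b * b\<close>: the square of norm (b - b u) is the norm of
  \<open>star (1 - u) * h * (1 - u)\<close>, at most 3 norm (h - h u).\<close>

lemma right_approximate_unit:
  fixes b :: "'a::cstar_algebra"
  assumes "0 < \<epsilon>"
  obtains u where "norm u \<le> 2" "norm (b - b * u) < \<epsilon>"
proof -
  define h where "h = star b * b"
  \<comment> \<open>The scaling makes the norm of \<open>g\<close> less than 1, and the factor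
    \<open>\<i>\<close> makes the selfadjoint \<open>h\<close> skew.\<close>
  define c where "c = 1 / (norm h + 1)"
  define g where "g = (\<i> * complex_of_real c) *\<^sub>C h"
  have c: "0 < c" by (simp add: c_def add_nonneg_pos)
  have "star g = cnj (\<i> * complex_of_real c) *\<^sub>C h"
    by (simp add: g_def star_scaleC h_def star_mult star_star)
  also have "\<dots> = - g"
  proof -
    interpret vector_space "scaleC :: complex \<Rightarrow> 'a \<Rightarrow> 'a" by (rule vector_space_scaleC)
    show ?thesis by (simp add: g_def)
  qed
  finally have star: "star g = - g" .
  have ng: "norm (g - g * u) = c * norm (h - h * u)" for u
  proof -
    have "g - g * u = (\<i> * complex_of_real c) *\<^sub>C (h - h * u)"
    proof -
      interpret vector_space "scaleC :: complex \<Rightarrow> 'a \<Rightarrow> 'a" by (rule vector_space_scaleC)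
      show ?thesis by (simp add: g_def mult_scaleC_left scale_right_diff_distrib)
    qed
    then show ?thesis using c by (simp add: norm_scaleC norm_mult)
  qed
  have "norm g < 1"
    using ng[of 0] c by (simp add: c_def)
  moreover have "0 < c * \<epsilon>\<^sup>2 / 3" using c assms by simp
  ultimately obtain u where u: "norm u \<le> 2" "norm (g - g * u) < c * \<epsilon>\<^sup>2 / 3"
    using skew_approximate_unit star by blast
  have hu: "norm (h - h * u) < \<epsilon>\<^sup>2 / 3"
    using u(2) c by (simp add: ng)
  have "(norm (b - b * u))\<^sup>2 = norm (star (b - b * u) * (b - b * u))"
    by (simp add: cstar_identity)
  also have "star (b - b * u) * (b - b * u) = (h - h * u) - star u * (h - h * u)"
    by (simp add: star_diff star_mult h_def algebra_simps)
  also have "norm \<dots> \<le> norm (h - h * u) + norm (star u) * norm (h - h * u)"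
    by (rule order_trans[OF norm_triangle_ineq4]) (simp add: norm_mult_ineq)
  also have "\<dots> \<le> 3 * norm (h - h * u)"
    using mult_right_mono[OF u(1), of "norm (h - h * u)"] by (simp add: norm_star)
  also have "\<dots> < \<epsilon>\<^sup>2" using hu by simp
  finally have "norm (b - b * u) < \<epsilon>"
    using assms by (simp add: power2_less_imp_less)
  with u that show ?thesis by blast
qed

text \<open>An approximate unit \<open>e\<close> of unknown norm for all of \<open>S\<close> is replaced by a bounded one \<open>u\<close>
  for \<open>e\<close> alone, since \<open>b - b u = (b - b e) - (b - b e) u + b (e - e u)\<close>.\<close>

lemma right_approximate_unit_finite:
  fixes S :: "'a::cstar_algebra set"
  assumes "finite S" "0 < \<epsilon>"
  obtains u where "norm u \<le> 2" "\<And>b. b \<in> S \<Longrightarrow> norm (b - b * u) < \<epsilon>"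
proof -
  have step: "norm (x - x * u) \<le> 3 * norm x" if "norm u \<le> 2" for x u :: 'a
  proof -
    have "norm (x - x * u) \<le> norm x + norm x * norm u"
      by (rule order_trans[OF norm_triangle_ineq4]) (simp add: norm_mult_ineq)
    also have "\<dots> \<le> 3 * norm x"
      using mult_left_mono[OF that, of "norm x"] by simp
    finally show ?thesis .
  qed
  have "\<exists>e. \<forall>b\<in>S. norm (b - b * e) < \<delta>" if "0 < \<delta>" for \<delta>
    using assms(1) that
  proof (induction arbitrary: \<delta>)
    case (insert x S)
    obtain e where e: "\<And>b. b \<in> S \<Longrightarrow> norm (b - b * e) < \<delta> / 3"
      using insert.IH[of "\<delta> / 3"] insert.prems by auto
    \<comment> \<open>\<open>u\<close> only has to treat the residue of the new element:
      \<open>1 - (e + u - e * u) = (1 - e) * (1 - u)\<close>, and on the old residues the factor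
      \<open>1 - u\<close> costs at most 3.\<close>
    obtain u where u: "norm u \<le> 2" "norm ((x - x * e) - (x - x * e) * u) < \<delta>"
      using right_approximate_unit insert.prems by blast
    have "norm (b - b * (e + u - e * u)) < \<delta>" if "b \<in> insert x S" for b
    proof -
      have eq: "b - b * (e + u - e * u) = (b - b * e) - (b - b * e) * u"
        by (simp add: algebra_simps)
      show ?thesis
      proof (cases "b = x")
        case True
        then show ?thesis unfolding eq using u by simp
      next
        case False
        then have "norm (b - b * e) < \<delta> / 3" using that e by simp
        then show ?thesis unfolding eq using step[OF u(1), of "b - b * e"] by simp
      qed
    qed
    then show ?case by blast
  qed simp
  \<comment> \<open>Both error terms stay within half of \<epsilon>: 3 times \<epsilon>/6, and
    \<open>M\<close> times \<epsilon>/(2M).\<close>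
  from this[of "\<epsilon> / 6"] obtain e where e: "\<And>b. b \<in> S \<Longrightarrow> norm (b - b * e) < \<epsilon> / 6"
    using assms(2) by auto
  obtain M where M: "0 < M" "\<And>b. b \<in> S \<Longrightarrow> norm b \<le> M"
    using finite_imp_bounded[OF assms(1)] by (auto simp: bounded_pos)
  have "0 < \<epsilon> / (2 * M)" using assms(2) M(1) by simp
  then obtain u where u: "norm u \<le> 2" "norm (e - e * u) < \<epsilon> / (2 * M)"
    using right_approximate_unit by blast
  have "norm (b - b * u) < \<epsilon>" if b: "b \<in> S" for b
  proof -
    have "b - b * u = ((b - b * e) - (b - b * e) * u) + b * (e - e * u)"
      by (simp add: algebra_simps)
    then have "norm (b - b * u) \<le> norm ((b - b * e) - (b - b * e) * u) + norm b * norm (e - e * u)"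
      by (metis norm_triangle_mono norm_mult_ineq order_refl)
    also have "norm b * norm (e - e * u) \<le> M * (\<epsilon> / (2 * M))"
      using M b u(2) by (intro mult_mono) auto
    also have "norm ((b - b * e) - (b - b * e) * u) \<le> 3 * norm (b - b * e)"
      by (rule step[OF u(1)])
    also have "3 * norm (b - b * e) + M * (\<epsilon> / (2 * M)) < \<epsilon>"
      using e[OF b] M(1) by simp
    finally show ?thesis by simp
  qed
  with u that show ?thesis by blast
qed

text \<open>A right unit \<open>v\<close> for the adjoints of \<open>S\<close> gives a left unit
  \<open>z = star v\<close> for \<open>S\<close>. Since \<open>1 - ?e = (1 - u) * (1 - z)\<close>,
  the combination \<open>?e\<close> works on both sides; 8 comes from 2 + 2 + 2 * 2.\<close>

lemma approximate_unit_finite: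
  fixes S :: "'a::cstar_algebra set"
  assumes "finite S" "0 < \<epsilon>"
  obtains e where "norm e \<le> 8"
    "\<And>b. b \<in> S \<Longrightarrow> norm (b - b * e) < \<epsilon>" "\<And>b. b \<in> S \<Longrightarrow> norm (b - e * b) < \<epsilon>"
proof -
  have 3: "0 < \<epsilon> / 3" using assms by simp
  obtain u where u: "norm u \<le> 2" "\<And>b. b \<in> S \<Longrightarrow> norm (b - b * u) < \<epsilon> / 3"
    using right_approximate_unit_finite[OF assms(1) 3] by blast
  obtain v where v: "norm v \<le> 2" "\<And>b. b \<in> star ` S \<Longrightarrow> norm (b - b * v) < \<epsilon> / 3"
    using right_approximate_unit_finite[OF finite_imageI[OF assms(1)] 3] by blast
  define z where "z = star v"
  have z: "norm z \<le> 2" using v by (simp add: z_def norm_star)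
  have zb: "norm (b - z * b) < \<epsilon> / 3" if "b \<in> S" for b
    using v(2)[of "star b"] that norm_star[of "b - z * b"]
    by (simp add: z_def star_diff star_mult star_star)
  let ?e = "u + z - u * z"
  have prod_le: "norm (x * y) \<le> 2 * norm x" "norm (y * x) \<le> 2 * norm x" if "norm y \<le> 2" for x y :: 'a
    using norm_mult_ineq[of x y] norm_mult_ineq[of y x] mult_left_mono[OF that, of "norm x"]
    by (simp_all add: mult.commute)
  have "norm ?e \<le> norm u + norm z + norm (u * z)"
    using norm_triangle_ineq4[of "u + z" "u * z"] norm_triangle_ineq[of u z] by linarith
  with prod_le(1)[OF z, of u] u z have "norm ?e \<le> 8" by linarith
  moreover have "norm (b - b * ?e) < \<epsilon>" if "b \<in> S" for b
  proof -
    have "b - b * ?e = (b - b * u) - (b - b * u) * z" by (simp add: algebra_simps)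
    then have "norm (b - b * ?e) \<le> norm (b - b * u) + norm ((b - b * u) * z)"
      by (metis norm_triangle_ineq4)
    with prod_le(1)[OF z, of "b - b * u"] u(2)[OF that] show ?thesis by linarith
  qed
  moreover have "norm (b - ?e * b) < \<epsilon>" if "b \<in> S" for b
  proof -
    have "b - ?e * b = (b - z * b) - u * (b - z * b)" by (simp add: algebra_simps)
    then have "norm (b - ?e * b) \<le> norm (b - z * b) + norm (u * (b - z * b))"
      by (metis norm_triangle_ineq4)
    with prod_le(2)[OF u(1), of "b - z * b"] zb[OF that] show ?thesis by linarith
  qed
  ultimately show ?thesis using that by blast
qed

lemma bounded_approximate_identity:
  obtains \<F> :: "'a::cstar_algebra filter" where "\<F> \<noteq> bot"
    "\<forall>\<^sub>F e in \<F>. norm e \<le> 8"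
    "\<And>b. ((\<lambda>e. b * e) \<longlongrightarrow> b) \<F>" "\<And>b. ((\<lambda>e. e * b) \<longlongrightarrow> b) \<F>"
proof -
  have "\<exists>e. norm e \<le> 8 \<and> (\<forall>b\<in>S. norm (b - b * e) < 1 / real (Suc n) \<and> norm (b - e * b) < 1 / real (Suc n))"
    if S: "finite S" for S :: "'a set" and n :: nat
    using approximate_unit_finite[OF S, of "1 / real (Suc n)"]
    by (metis of_nat_0_less_iff zero_less_Suc zero_less_divide_1_iff)
  then obtain e :: "'a set \<Rightarrow> nat \<Rightarrow> 'a" where e: "\<And>S n. finite S \<Longrightarrow> norm (e S n) \<le> 8"
    "\<And>S n b. finite S \<Longrightarrow> b \<in> S \<Longrightarrow> norm (b - b * e S n) < 1 / real (Suc n)"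
    "\<And>S n b. finite S \<Longrightarrow> b \<in> S \<Longrightarrow> norm (b - e S n * b) < 1 / real (Suc n)"
    by metis
  \<comment> \<open>The index runs over finite sets and precisions together; a sequence might not
    serve a nonseparable algebra.\<close>
  let ?N = "finite_subsets_at_top (UNIV :: 'a set) \<times>\<^sub>F (sequentially :: nat filter)"
  define \<F> where "\<F> = filtermap (\<lambda>(S, n). e S n) ?N"
  have fin: "\<forall>\<^sub>F S in finite_subsets_at_top (UNIV :: 'a set). finite S"
    by (auto simp: eventually_finite_subsets_at_top)
  have mem: "\<forall>\<^sub>F S in finite_subsets_at_top UNIV. finite S \<and> b \<in> S" for b :: 'a
    by (auto simp: eventually_finite_subsets_at_top intro!: exI[of _ "{b}"])
  have inv: "\<forall>\<^sub>F n in sequentially. 1 / real (Suc n) < \<epsilon>" if "0 < \<epsilon>" for \<epsilon>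
    using order_tendstoD(2)[OF LIMSEQ_inverse_real_of_nat that] by (simp add: inverse_eq_divide)
  have ev: "\<forall>\<^sub>F i in ?N. (finite (fst i) \<and> b \<in> fst i) \<and> 1 / real (Suc (snd i)) < \<epsilon>"
    if "0 < \<epsilon>" for b \<epsilon>
    using eventually_prodI[OF mem[of b] inv[OF that]] .
  show ?thesis
  proof
    show "\<F> \<noteq> bot"
      by (simp add: \<F>_def filtermap_bot_iff prod_filter_eq_bot)
    have "\<forall>\<^sub>F i in ?N. finite (fst i) \<and> True"
      using eventually_prodI[OF fin, of "\<lambda>_. True"] by simp
    then show "\<forall>\<^sub>F e in \<F>. norm e \<le> 8"
      unfolding \<F>_def eventually_filtermap by eventually_elim (auto simp: e split: prod.split)
    show "((\<lambda>e. b * e) \<longlongrightarrow> b) \<F>" for b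
    proof (rule tendstoI)
      fix \<epsilon> :: real assume "0 < \<epsilon>"
      from ev[OF this, of b] show "\<forall>\<^sub>F x in \<F>. dist (b * x) b < \<epsilon>"
        unfolding \<F>_def eventually_filtermap
        by eventually_elim (auto simp: dist_norm norm_minus_commute split: prod.split
            intro: order.strict_trans[OF e(2)])
    qed
    show "((\<lambda>e. e * b) \<longlongrightarrow> b) \<F>" for b
    proof (rule tendstoI)
      fix \<epsilon> :: real assume "0 < \<epsilon>"
      from ev[OF this, of b] show "\<forall>\<^sub>F x in \<F>. dist (x * b) b < \<epsilon>"
        unfolding \<F>_def eventually_filtermap
        by eventually_elim (auto simp: dist_norm norm_minus_commute split: prod.split
            intro: order.strict_trans[OF e(3)])
    qed
  qed
qed

section \<open>Weak* compactness\<close>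

text \<open>Tychonoff's theorem, carried over to the topology of the function type.\<close>

lemma compact_PiE_UNIV:
  fixes K :: "'i \<Rightarrow> 'b::topological_space set"
  assumes "\<And>i. compact (K i)"
  shows "compact (PiE UNIV K)"
proof -
  have "compactin (product_topology (\<lambda>_. euclidean) UNIV) (PiE UNIV K)"
    using assms by (auto simp: compactin_PiE)
  then show ?thesis by (simp add: euclidean_product_topology)
qed

lemma cdual_apply_right:
  "cdual_apply f (x + y) = cdual_apply f x + cdual_apply f y"
  "cdual_apply f (c *\<^sub>C x) = c * cdual_apply f x"
  using clinear_cdual_apply[of f] by (simp_all add: clinear_iff scaleC_complex_def)

text \<open>Banach-Alaoglu for filters: bounded functionals lie in a product of discs, which is
  compact. Passing to a finer filter turns the cluster point into a limit and keeps all limits along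
  \<F>.\<close>

lemma weak_star_cluster_point:
  fixes X :: "'i \<Rightarrow> 'm::complex_normed_vector cdual"
  assumes "\<F> \<noteq> bot" "\<forall>\<^sub>F i in \<F>. norm (X i) \<le> C"
  obtains \<G> \<xi> where "\<G> \<le> \<F>" "\<G> \<noteq> bot"
    "\<And>x. ((\<lambda>i. cdual_apply (X i) x) \<longlongrightarrow> cdual_apply \<xi> x) \<G>"
proof -
  define K where "K = PiE UNIV (\<lambda>x :: 'm. cball (0 :: complex) (C * norm x))"
  define \<phi> where "\<phi> = (\<lambda>i. cdual_apply (X i))"
  have "compact K" unfolding K_def by (rule compact_PiE_UNIV) simp
  moreover have "\<forall>\<^sub>F p in filtermap \<phi> \<F>. p \<in> K"
    unfolding eventually_filtermap using assms(2)
  proof eventually_elim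
    case (elim i)
    have "norm (cdual_apply (X i) x) \<le> C * norm x" for x
      using norm_cdual_apply_le[of "X i" x] mult_right_mono[OF elim norm_ge_zero, of x] by linarith
    then show ?case by (auto simp: K_def \<phi>_def)
  qed
  moreover have "filtermap \<phi> \<F> \<noteq> bot" using assms(1) by (simp add: filtermap_bot_iff)
  ultimately obtain p where p: "p \<in> K" "inf (nhds p) (filtermap \<phi> \<F>) \<noteq> bot"
    unfolding compact_filter by blast
  define \<G> where "\<G> = inf (filtercomap \<phi> (nhds p)) \<F>"
  have le: "\<G> \<le> \<F>" by (simp add: \<G>_def)
  have ne: "\<G> \<noteq> bot"
  proof
    assume "\<G> = bot"
    \<comment> \<open>If the refinement were trivial, \<open>P\<close> would be a neighbourhood of
      \<open>p\<close> that the functionals eventually avoid, so \<open>p\<close> would not be a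
      cluster point.\<close>
    then obtain P Q where PQ: "eventually P (nhds p)" "eventually Q \<F>" "\<And>i. P (\<phi> i) \<Longrightarrow> \<not> Q i"
      unfolding trivial_limit_def \<G>_def eventually_inf eventually_filtercomap by blast
    have "\<forall>\<^sub>F q in filtermap \<phi> \<F>. \<not> P q"
      unfolding eventually_filtermap using PQ(2) by eventually_elim (use PQ(3) in blast)
    with PQ(1) have "eventually (\<lambda>_. False) (inf (nhds p) (filtermap \<phi> \<F>))"
      unfolding eventually_inf by blast
    with p(2) show False by (simp add: trivial_limit_def)
  qed
  have "filterlim \<phi> (nhds p) \<G>"
    unfolding filterlim_iff_le_filtercomap \<G>_def by simp
  then have lim: "((\<lambda>i. cdual_apply (X i) x) \<longlongrightarrow> p x) \<G>" for x
    using continuous_on_tendsto_compose[OF continuous_on_product_coordinates[of x], of \<phi> p \<G>]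
    by (simp add: \<phi>_def)
  have add: "p (x + y) = p x + p y" for x y
    using tendsto_unique[OF ne lim[of "x + y"]] tendsto_add[OF lim[of x] lim[of y]]
    by (simp add: cdual_apply_right)
  have scaleC: "p (c *\<^sub>C x) = c * p x" for c x
    using tendsto_unique[OF ne lim[of "c *\<^sub>C x"]] tendsto_mult_left[OF lim[of x], of c]
    by (simp add: cdual_apply_right)
  have "bounded_linear p"
  proof (rule bounded_linear_intro[where K = C])
    show "norm (p x) \<le> norm x * C" for x
      using p(1) by (auto simp: K_def PiE_iff mult.commute)
  qed (simp_all add: add scaleC scaleR_scaleC scaleC_complex_def)
  moreover have "clinear p" by (simp add: clinear_iff add scaleC scaleC_complex_def)
  ultimately have "cdual_apply (cdual_of p) = p" by (rule cdual_apply_cdual_of)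
  with lim that[OF le ne, of "cdual_of p"] show ?thesis by simp
qed

lemma norm_to_bidual_le: "norm (to_bidual x) \<le> norm x"
  using norm_cdual_apply_le[of _ x]
  by (intro norm_cdual_le) (simp_all add: cdual_apply_to_bidual mult.commute)

lemma to_bidual_simps:
  "to_bidual (x + y) = to_bidual x + to_bidual y"
  "to_bidual (c *\<^sub>C x) = c *\<^sub>C to_bidual x"
  by (rule cdual_eqI; simp add: cdual_apply_to_bidual cdual_apply_add cdual_apply_scaleC
      cdual_apply_right)+

section \<open>Generalized derivations of the third type\<close>

lemma bounded_linear_of_clinear_continuous:
  fixes F :: "'a::complex_normed_vector \<Rightarrow> 'b::complex_normed_vector"
  assumes "clinear F" "continuous_on UNIV F"
  shows "bounded_linear F"
proof -
  have add: "F (x + y) = F x + F y" and scaleR: "F (r *\<^sub>R x) = r *\<^sub>R F x" for x y r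
    using assms(1) by (simp_all add: clinear_iff scaleR_scaleC)
  have F0: "F 0 = 0" using scaleR[of 0 0] by simp
  obtain \<delta> where \<delta>: "0 < \<delta>" "\<And>x. norm x < \<delta> \<Longrightarrow> norm (F x) < 1"
    using assms(2)[unfolded continuous_on_iff, rule_format, of 0 1] by (auto simp: F0)
  show ?thesis
  proof (rule bounded_linear_intro[OF add scaleR])
    show "norm (F x) \<le> norm x * (2 / \<delta>)" for x
    proof (cases "x = 0")
      case False
      \<comment> \<open>Scales \<open>x\<close> to norm \<delta>/2.\<close>
      define r where "r = \<delta> / (2 * norm x)"
      have r: "0 < r" using False \<delta> by (simp add: r_def)
      have "norm (r *\<^sub>R x) < \<delta>" using False \<delta> by (simp add: r_def)
      from \<delta>(2)[OF this] r have "r * norm (F x) < 1" by (simp add: scaleR)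
      then have "norm (F x) \<le> 1 / r" using r by (simp add: field_simps)
      then show ?thesis by (simp add: r_def mult.commute)
    qed (simp add: F0)
  qed
qed

section \<open>Eliminating G and H\<close>

context banach_bimodule
begin

text \<open>Splitting each product between \<open>b\<close> and \<open>c\<close> leaves only the
  values \<open>G (a * b)\<close>, \<open>G b\<close>, \<open>H (c * d)\<close> and
  \<open>H c\<close>. Each occurs in one term on either side, so they match although
  \<open>G\<close> and \<open>H\<close> are arbitrary maps.\<close>

lemma third_type_identity_product:
  assumes "\<And>a b. F (a * b) = R (G a) b + L a (H b)"
  shows "F (a * (b * c) * d) + L a (R (F (b * c)) d) = R (F (a * (b * c))) d + L a (F (b * c * d))"
proof -
  interpret bL: bounded_bilinear L by (rule bounded_bilinear_left)
  interpret bR: bounded_bilinear R by (rule bounded_bilinear_right)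
  have "F (a * (b * c) * d) = R (G (a * b)) (c * d) + L (a * b) (H (c * d))"
    using assms[of "a * b" "c * d"] by (simp add: mult.assoc)
  moreover have "F (a * (b * c)) = R (G (a * b)) c + L (a * b) (H c)"
    using assms[of "a * b" c] by (simp add: mult.assoc)
  moreover have "F (b * c * d) = R (G b) (c * d) + L b (H (c * d))"
    using assms[of b "c * d"] by (simp add: mult.assoc)
  moreover have "F (b * c) = R (G b) c + L b (H c)"
    by (rule assms)
  ultimately show ?thesis
    by (simp add: bL.add_right bR.add_left left_mult right_mult left_right)
qed

end

text \<open>The middle factor is approximated by the products \<open>b * e\<close>. The identity for
  products mentions only \<open>F\<close> and the actions, all continuous, so it survives the
  limit.\<close>

lemma third_type_identity:
  fixes L :: "'a::cstar_algebra \<Rightarrow> 'm::complex_banach \<Rightarrow> 'm"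
  assumes "banach_bimodule L R" and F: "bounded_linear F"
    and GH: "\<And>a b. F (a * b) = R (G a) b + L a (H b)"
  shows "F (a * b * c) + L a (R (F b) c) = R (F (a * b)) c + L a (F (b * c))"
proof -
  interpret banach_bimodule L R by fact
  obtain \<F> :: "'a filter" where ne: "\<F> \<noteq> bot" and lim: "((\<lambda>e. b * e) \<longlongrightarrow> b) \<F>"
    using bounded_approximate_identity by metis
  note lims = bounded_linear.tendsto[OF F] bounded_bilinear.tendsto[OF bounded_bilinear_left]
    bounded_bilinear.tendsto[OF bounded_bilinear_right] tendsto_add tendsto_mult tendsto_const lim
  have "((\<lambda>e. F (a * (b * e) * c) + L a (R (F (b * e)) c)) \<longlongrightarrow> F (a * b * c) + L a (R (F b) c)) \<F>"
    by (intro lims)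
  moreover have "((\<lambda>e. R (F (a * (b * e))) c + L a (F (b * e * c))) \<longlongrightarrow>
      R (F (a * b)) c + L a (F (b * c))) \<F>"
    by (intro lims)
  ultimately show ?thesis
    using tendsto_unique[OF ne] by (simp add: third_type_identity_product[OF GH])
qed

lemma third_type_imp_second_type:
  fixes L :: "'a::cstar_algebra \<Rightarrow> 'm::complex_banach \<Rightarrow> 'm"
  assumes "banach_bimodule L R" and F: "bounded_linear F"
    and GH: "\<And>a b. F (a * b) = R (G a) b + L a (H b)"
  obtains \<xi> where "\<And>a b. to_bidual (F (a * b)) + bidual_right R (bidual_left L a \<xi>) b =
    to_bidual (R (F a) b) + to_bidual (L a (F b))"
proof -
  interpret banach_bimodule L R by fact
  obtain \<F> :: "'a filter" where \<F>: "\<F> \<noteq> bot" "\<forall>\<^sub>F e in \<F>. norm e \<le> 8"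
    "\<And>b. ((\<lambda>e. b * e) \<longlongrightarrow> b) \<F>" "\<And>b. ((\<lambda>e. e * b) \<longlongrightarrow> b) \<F>"
    using bounded_approximate_identity by metis
  obtain C where C: "0 \<le> C" "\<And>x. norm (F x) \<le> norm x * C"
    using bounded_linear.nonneg_bounded[OF F] by blast
  have "\<forall>\<^sub>F e in \<F>. norm (to_bidual (F e)) \<le> 8 * C"
    using \<F>(2)
  proof eventually_elim
    case (elim e)
    from mult_right_mono[OF elim C(1)] C(2)[of e] norm_to_bidual_le[of "F e"]
    show ?case by linarith
  qed
  \<comment> \<open>The embedded values \<open>to_bidual (F e)\<close> are bounded in the bidual,
    hence converge weak* along a finer filter.\<close>
  then obtain \<G> \<xi> where \<G>: "\<G> \<le> \<F>" "\<G> \<noteq> bot"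
    and \<xi>: "\<And>f. ((\<lambda>e. cdual_apply f (F e)) \<longlongrightarrow> cdual_apply \<xi> f) \<G>"
    using weak_star_cluster_point[OF \<F>(1), of "\<lambda>e. to_bidual (F e)" "8 * C"]
    unfolding cdual_apply_to_bidual by metis
  note approx = tendsto_mono[OF \<G>(1) \<F>(3)] tendsto_mono[OF \<G>(1) \<F>(4)]
  note lims = bounded_linear.tendsto[OF F] bounded_bilinear.tendsto[OF bounded_bilinear_left]
    bounded_bilinear.tendsto[OF bounded_bilinear_right] tendsto_add
    bounded_linear.tendsto[OF bounded_linear_cdual_apply]
  \<comment> \<open>The functional \<open>dual_right L (dual_left R b f) a\<close> sends x to f(a x
    b), so pairing it with \<xi> is pairing a \<xi> b with \<open>f\<close>. Weak* convergence at
    this one functional suffices; the identity with middle factor \<open>e\<close> then yields two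
    limits of one expression.\<close>
  have "cdual_apply f (F (a * b)) + cdual_apply \<xi> (dual_right L (dual_left R b f) a) =
      cdual_apply f (R (F a) b + L a (F b))" for a b f
  proof (rule tendsto_unique[OF \<G>(2)])
    have "((\<lambda>e. cdual_apply f (F (a * e * b)) + cdual_apply (dual_right L (dual_left R b f) a) (F e))
        \<longlongrightarrow> cdual_apply f (F (a * b)) + cdual_apply \<xi> (dual_right L (dual_left R b f) a)) \<G>"
      by (intro lims \<xi> approx tendsto_mult tendsto_const)
    also have "(\<lambda>e. cdual_apply f (F (a * e * b)) + cdual_apply (dual_right L (dual_left R b f) a) (F e)) =
        (\<lambda>e. cdual_apply f (R (F (a * e)) b + L a (F (e * b))))"
      by (simp add: cdual_apply_dual_left cdual_apply_dual_right left_right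
          third_type_identity[OF assms, symmetric] flip: cdual_apply_right)
    finally show "((\<lambda>e. cdual_apply f (R (F (a * e)) b + L a (F (e * b)))) \<longlongrightarrow>
        cdual_apply f (F (a * b)) + cdual_apply \<xi> (dual_right L (dual_left R b f) a)) \<G>" .
    show "((\<lambda>e. cdual_apply f (R (F (a * e)) b + L a (F (e * b)))) \<longlongrightarrow>
        cdual_apply f (R (F a) b + L a (F b))) \<G>"
      by (intro lims approx tendsto_const)
  qed
  then have "to_bidual (F (a * b)) + bidual_right R (bidual_left L a \<xi>) b =
      to_bidual (R (F a) b) + to_bidual (L a (F b))" for a b
    by (intro cdual_eqI) (simp add: cdual_apply_add cdual_apply_to_bidual cdual_apply_bidual_left
        cdual_apply_bidual_right cdual_apply_right)
  with that show ?thesis by blast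
qed

theorem proposition2p5:
  fixes L :: "'a::cstar_algebra \<Rightarrow> 'm::complex_banach \<Rightarrow> 'm"
    and R :: "'m \<Rightarrow> 'a \<Rightarrow> 'm"
    and F :: "'a \<Rightarrow> 'm"
  assumes "banach_bimodule L R"
    and "generalized_derivation_third L R F"
    and "continuous_on UNIV F"
  shows "generalized_derivation_first L R F \<and> generalized_derivation_second L R F"
proof -
  interpret banach_bimodule L R by fact
  interpret bidual: banach_bimodule "bidual_left L" "bidual_right R"
    by (rule banach_bimodule_bidual)
  interpret bL: bounded_bilinear "bidual_left L" by (rule bidual.bounded_bilinear_left)
  interpret bR: bounded_bilinear "bidual_right R" by (rule bidual.bounded_bilinear_right)
  obtain G H where lin: "clinear F" and GH: "\<And>a b. F (a * b) = R (G a) b + L a (H b)"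
    using assms(2) by (auto simp: generalized_derivation_third_def)
  obtain \<xi> where \<xi>: "\<And>a b. to_bidual (F (a * b)) + bidual_right R (bidual_left L a \<xi>) b =
      to_bidual (R (F a) b) + to_bidual (L a (F b))"
    using third_type_imp_second_type[OF assms(1) bounded_linear_of_clinear_continuous[OF lin assms(3)] GH]
    by blast
  have \<xi>': "to_bidual (F (a * b)) = to_bidual (R (F a) b) + to_bidual (L a (F b))
      - bidual_right R (bidual_left L a \<xi>) b" for a b
    using \<xi> by (metis add_diff_cancel_right')
  \<comment> \<open>The correction \<xi> b is chosen so that a d(b) = a F(b) - a \<xi> b, which is
    the second-type identity in first-type form. In d(ab) the extra term - \<xi> a b completes F(a)
    b to d(a) b.\<close>
  define d where "d b = to_bidual (F b) - bidual_right R \<xi> b" for b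
  interpret bd: vector_space "scaleC :: complex \<Rightarrow> 'm cdual cdual \<Rightarrow> 'm cdual cdual"
    by (rule vector_space_scaleC)
  have "clinear d"
    using lin by (simp add: clinear_iff d_def to_bidual_simps bR.add_right bidual.right_scaleC
        bd.scale_right_diff_distrib)
  moreover have "d (a * b) = bidual_right R (d a) b + bidual_left L a (d b)" for a b
    by (simp add: d_def \<xi>' bL.diff_right bR.diff_left bidual_left_to_bidual bidual_right_to_bidual
        bidual.right_mult bidual.left_right)
  moreover have "to_bidual (F (a * b)) = to_bidual (R (F a) b) + bidual_left L a (d b)" for a b
    by (simp add: d_def \<xi>' bL.diff_right bidual_left_to_bidual bidual.left_right)
  ultimately have "generalized_derivation_first L R F"
    using lin unfolding generalized_derivation_first_def derivation_def by blast
  moreover have "generalized_derivation_second L R F"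
    using lin \<xi>' unfolding generalized_derivation_second_def by blast
  ultimately show ?thesis ..
qed

end
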